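(* Let $r:[\underline{\tau},\overline{\tau}]\to\mathbb{R}^2$ be a $C^3$-class plane curve satisfying the standing assumptions in the context, with equidistant partitions $F^{\Delta}$, points $p_i^{\Delta}$ and approximating polygonal curves $P^{\Delta}$ as defined there. If $\Delta$ is sufficiently small, then there exist values $k(\Delta),K(\Delta)$ such that the side $[p_i^{\Delta},p_{i+1}^{\Delta}]$ of $P^{\Delta}$ contains an equilibrium point of $P^{\Delta}$ (with respect to $o$) if, and only if, $k(\Delta)\le i\le K(\Delta)$. In particular, the curve $r$ has no irregular equilibrium sequences.
   Context: Standing assumptions. The reference point $o$ is the origin of $\mathbb{R}^2$. $r(\tau)=(x(\tau),y(\tau))$, $\tau\in[\underline{\tau},\overline{\tau}]$ with $\underline{\tau}<0<\overline{\tau}$, is a simple $C^3$-class curve with $\dot{x}>0$. An equilibrium point of $r$ with respect to $o$ is a point $r(\tau)$ at which $\frac{d}{d\tau}|r(\tau)|=0$ (equivalently $\langle r(\tau),\dot r(\tau)\rangle=0$). The curve has exactly one equilibrium point $m$ with respect to $o$, and $m=r(0)=(0,\rho)$ with $\rho>0$ (so $\dot y(0)=0$). The signed curvature $\kappa$ of $r$ at $m$ (the sign being such that $\kappa=f''(0)$ if the curve is written near $m$ as a graph $y=f(x)$) satisfies $0\neq 1+\kappa\rho<1$; that is, $m$ is non-degenerate and $r$ is locally convex at $m$ with respect to $o$. Discretization. For a positive integer $n$, $F^{\Delta}$ is the $n$-segment equidistant partition of $[\underline{\tau},\overline{\tau}]$, with $\Delta=(\overline{\tau}-\underline{\tau})/n$.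 The division points of $F^{\Delta}$ are written as $i\Delta$, where $i$ is a real number (not necessarily an integer; the indices $i$ occurring are congruent mod $1$); $I$ denotes the set of these indices, and $p_i^{\Delta}=r(i\Delta)$ for $i\in I$. The approximating curve is $P^{\Delta}=\bigcup_{i-1,i\in I}[p_{i-1}^{\Delta},p_i^{\Delta}]$. Equilibria of $P^{\Delta}$ with respect to $o$: there is a stable equilibrium point on the side $[p_i^{\Delta},p_{i+1}^{\Delta}]$ if and only if $\langle p_i^{\Delta},p_{i+1}^{\Delta}-p_i^{\Delta}\rangle<0<\langle p_{i+1}^{\Delta},p_{i+1}^{\Delta}-p_i^{\Delta}\rangle$ (it is the orthogonal projection of $o$ on the side, a local minimum of the distance from $o$); a vertex $p_i^{\Delta}$ ($i-1,i,i+1\in I$) is an unstable equilibrium point if the distance from $o$, restricted to $P^{\Delta}$, has a local maximum there. These equilibria are assumed to be generic: if $P^{\Delta}$ has an equilibrium point at a vertex $p_i^{\Delta}$, then $p_i^{\Delta}$ is perpendicular to neither $p_{i+1}^{\Delta}-p_i^{\Delta}$ nor $p_{i-1}^{\Delta}-p_i^{\Delta}$. Irregular equilibrium sequence: a sequence $\{p_{i_k}^{\Delta_k}\}$ where $p_{i_k}^{\Delta_k}$ is an equilibrium point of $P^{\Delta_k}$ for every $k$, $\lim_{k\to\infty}\Delta_k=0$ and $\lim_{k\to\infty}i_k=\infty$. *)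

theory Defs
  imports "HOL-Analysis.Analysis"
begin

section \<open>Plane curves on a compact interval\<close>

text \<open>Derivatives of a curve on \<open>{a..b}\<close> are taken within \<open>{a..b}\<close>, hence are one-sided at the
  end points.\<close>

definition velocity :: "real \<Rightarrow> real \<Rightarrow> (real \<Rightarrow> 'a::real_normed_vector) \<Rightarrow> real \<Rightarrow> 'a" where
  "velocity a b r t = vector_derivative r (at t within {a..b})"

fun C_k_curve :: "nat \<Rightarrow> real \<Rightarrow> real \<Rightarrow> (real \<Rightarrow> 'a::real_normed_vector) \<Rightarrow> bool" where
  "C_k_curve 0 a b r \<longleftrightarrow> continuous_on {a..b} r"
| "C_k_curve (Suc k) a b r \<longleftrightarrow> r differentiable_on {a..b} \<and> C_k_curve k a b (velocity a b r)"

text \<open>The sign is such that the graph \<open>t \<mapsto> (t, f t)\<close> has curvature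
  \<open>f'' / (1 + f'\<^sup>2) powr (3/2)\<close>, i.e. \<open>f''\<close> where \<open>f' = 0\<close>.\<close>

definition signed_curvature :: "real \<Rightarrow> real \<Rightarrow> (real \<Rightarrow> real \<times> real) \<Rightarrow> real \<Rightarrow> real" where
  "signed_curvature a b r t =
     (let v = velocity a b r t; w = velocity a b (velocity a b r) t
      in (fst v * snd w - snd v * fst w) / norm v ^ 3)"

text \<open>The reference point is the origin. The condition \<open>r t \<bullet> r' t = 0\<close> is the vanishing of the
  derivative of \<open>\<bar>r t\<bar>\<close> wherever the latter is differentiable, see
  \<open>norm_has_real_derivative_0_iff\<close>; it also counts a passage of the curve through the origin.\<close>

definition curve_equilibria :: "real \<Rightarrow> real \<Rightarrow> (real \<Rightarrow> 'a::real_inner) \<Rightarrow> 'a set" where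
  "curve_equilibria a b r = {r t | t. t \<in> {a..b} \<and> r t \<bullet> velocity a b r t = 0}"

lemma norm_has_real_derivative_0_iff:
  fixes r :: "real \<Rightarrow> 'a::real_inner"
  assumes "a < b" "t \<in> {a..b}" "r differentiable (at t within {a..b})" "r t \<noteq> 0"
  shows "((\<lambda>s. norm (r s)) has_real_derivative 0) (at t within {a..b})
           \<longleftrightarrow> r t \<bullet> velocity a b r t = 0"
proof -
  let ?F = "at t within {a..b}"
  have r: "(r has_derivative (\<lambda>h. h *\<^sub>R velocity a b r t)) ?F"
    using assms(3) vector_derivative_works[of r ?F]
    by (simp add: has_vector_derivative_def velocity_def)
  have "((\<lambda>s. norm (r s)) has_derivative (\<lambda>h. (h *\<^sub>R velocity a b r t) \<bullet> sgn (r t))) ?F"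
    using has_derivative_compose[OF r has_derivative_norm[OF assms(4)]] by simp
  then have D: "((\<lambda>s. norm (r s)) has_real_derivative (velocity a b r t \<bullet> sgn (r t))) ?F"
    by (simp add: has_field_derivative_def mult_commute_abs)
  have nt: "?F \<noteq> bot"
    using assms(1,2) by (simp add: trivial_limit_within islimpt_Icc)
  have "((\<lambda>s. norm (r s)) has_real_derivative 0) ?F \<longleftrightarrow> velocity a b r t \<bullet> sgn (r t) = 0"
  proof
    assume "((\<lambda>s. norm (r s)) has_real_derivative 0) ?F"
    then show "velocity a b r t \<bullet> sgn (r t) = 0"
      using tendsto_unique[OF nt] D unfolding has_field_derivative_iff by blast
  next
    assume "velocity a b r t \<bullet> sgn (r t) = 0"
    then show "((\<lambda>s. norm (r s)) has_real_derivative 0) ?F"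
      using D by simp
  qed
  also have "\<dots> \<longleftrightarrow> r t \<bullet> velocity a b r t = 0"
    using assms(4) by (simp add: sgn_div_norm inner_commute)
  finally show ?thesis .
qed


section \<open>Equidistant partitions and approximating polygons\<close>

text \<open>The parameter \<open>n\<close> is the number of segments; it determines the step \<open>\<Delta> = mesh a b n\<close>.\<close>

definition mesh :: "real \<Rightarrow> real \<Rightarrow> nat \<Rightarrow> real" where
  "mesh a b n = (b - a) / real n"

definition division_points :: "real \<Rightarrow> real \<Rightarrow> nat \<Rightarrow> real set" where
  "division_points a b n = {a + real j * mesh a b n | j. j \<le> n}"

text \<open>Indices are real numbers: the parameter \<open>0\<close> need not be a division point, so the indices
  are a translate of \<open>{0, \<dots>, n}\<close> which in general is not contained in the integers.\<close>

definition indices :: "real \<Rightarrow> real \<Rightarrow> nat \<Rightarrow> real set" where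
  "indices a b n = {i. i * mesh a b n \<in> division_points a b n}"

definition vertex :: "real \<Rightarrow> real \<Rightarrow> (real \<Rightarrow> 'a) \<Rightarrow> nat \<Rightarrow> real \<Rightarrow> 'a" where
  "vertex a b r n i = r (i * mesh a b n)"

definition side :: "real \<Rightarrow> real \<Rightarrow> (real \<Rightarrow> 'a::real_vector) \<Rightarrow> nat \<Rightarrow> real \<Rightarrow> 'a set" where
  "side a b r n i = closed_segment (vertex a b r n i) (vertex a b r n (i + 1))"

definition polygon :: "real \<Rightarrow> real \<Rightarrow> (real \<Rightarrow> 'a::real_vector) \<Rightarrow> nat \<Rightarrow> 'a set" where
  "polygon a b r n = (\<Union>i \<in> {i. i \<in> indices a b n \<and> i + 1 \<in> indices a b n}. side a b r n i)"


section \<open>Equilibria of the polygons with respect to the origin\<close>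

text \<open>The last two conjuncts say that \<open>q\<close> is the orthogonal projection of the origin on the side.\<close>

definition stable_equilibrium ::
    "real \<Rightarrow> real \<Rightarrow> (real \<Rightarrow> 'a::real_inner) \<Rightarrow> nat \<Rightarrow> real \<Rightarrow> 'a \<Rightarrow> bool" where
  "stable_equilibrium a b r n i q \<longleftrightarrow>
     (let p = vertex a b r n i; p' = vertex a b r n (i + 1)
      in i \<in> indices a b n \<and> i + 1 \<in> indices a b n
         \<and> p \<bullet> (p' - p) < 0 \<and> 0 < p' \<bullet> (p' - p)
         \<and> q \<in> side a b r n i \<and> q \<bullet> (p' - p) = 0)"

definition unstable_equilibrium ::
    "real \<Rightarrow> real \<Rightarrow> (real \<Rightarrow> 'a::real_inner) \<Rightarrow> nat \<Rightarrow> real \<Rightarrow> bool" where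
  "unstable_equilibrium a b r n i \<longleftrightarrow>
     i - 1 \<in> indices a b n \<and> i \<in> indices a b n \<and> i + 1 \<in> indices a b n
     \<and> (\<forall>\<^sub>F z in at (vertex a b r n i) within polygon a b r n. norm z \<le> norm (vertex a b r n i))"

definition polygon_equilibria ::
    "real \<Rightarrow> real \<Rightarrow> (real \<Rightarrow> 'a::real_inner) \<Rightarrow> nat \<Rightarrow> 'a set" where
  "polygon_equilibria a b r n =
     {q. \<exists>i. stable_equilibrium a b r n i q}
     \<union> {vertex a b r n i | i. unstable_equilibrium a b r n i}"

definition generic_equilibria ::
    "real \<Rightarrow> real \<Rightarrow> (real \<Rightarrow> 'a::real_inner) \<Rightarrow> nat \<Rightarrow> bool" where
  "generic_equilibria a b r n \<longleftrightarrow>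
     (\<forall>i. i - 1 \<in> indices a b n \<and> i \<in> indices a b n \<and> i + 1 \<in> indices a b n
          \<and> vertex a b r n i \<in> polygon_equilibria a b r n \<longrightarrow>
          vertex a b r n i \<bullet> (vertex a b r n (i + 1) - vertex a b r n i) \<noteq> 0
          \<and> vertex a b r n i \<bullet> (vertex a b r n (i - 1) - vertex a b r n i) \<noteq> 0)"

definition irregular_equilibrium_sequence ::
    "real \<Rightarrow> real \<Rightarrow> (real \<Rightarrow> 'a::real_inner) \<Rightarrow> (nat \<Rightarrow> nat) \<Rightarrow> (nat \<Rightarrow> real) \<Rightarrow> bool" where
  "irregular_equilibrium_sequence a b r n i \<longleftrightarrow>
     (\<forall>k. 0 < n k \<and> i k \<in> indices a b (n k)
          \<and> vertex a b r (n k) (i k) \<in> polygon_equilibria a b r (n k))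
     \<and> (\<lambda>k. mesh a b (n k)) \<longlonglongrightarrow> 0
     \<and> filterlim i at_top sequentially"

end

theory Submission
  imports Defs
begin

text \<open>
  Say that a point \<open>x\<close> approaches \<open>y\<close> if the distance from the origin starts to decrease when
  one moves from \<open>x\<close> straight towards \<open>y\<close>, that is, if \<open>x \<bullet> (y - x) < 0\<close>. All equilibria of the
  polygon can be read off from which vertices approach their neighbours: a side carries a stable
  equilibrium iff its end points approach each other, and a vertex is unstable iff it approaches
  both neighbours (\<open>ex_stable_equilibrium_iff\<close>, \<open>unstable_equilibrium_iff\<close>). Since the abscissa
  increases along the curve, distinct sides meet only at common vertices, so a side contains an
  equilibrium iff it carries a stable one or one of its end points is unstable
  (\<open>side_has_equilibrium_iff\<close>).

  Write \<open>q t = r t \<bullet> r' t\<close>, the derivative of half the squared distance. By hypothesis \<open>q\<close> vanishes only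
  at \<open>0\<close>, and \<open>c = q' 0\<close> is a positive multiple of \<open>1 + \<kappa> \<rho>\<close>, hence not zero. So \<open>\<bar>q t\<bar>\<close> is
  at least a multiple of \<open>\<bar>t\<bar>\<close>. A point \<open>r t\<close> that approaches a point at parameter distance
  \<open>h\<close> ahead forces \<open>q t < const * h\<close>, and approaching a point behind forces the opposite
  estimate. Together they give \<open>\<bar>t\<bar> \<le> M * h\<close>: for every mesh, the indices of all equilibria lie in
  \<open>{-M..M}\<close> (\<open>two_sided_approach_only_near_0\<close>). This excludes irregular sequences at once.

  On this bounded range of indices the forward and backward increments of the curve satisfy
  \<open>r (u h) \<bullet> (r (u h \<plusminus> h) - r (u h)) = (\<plusminus> c u + k) h\<^sup>2 + o(h\<^sup>2)\<close> uniformly in \<open>u\<close>, with a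
  constant \<open>k\<close>. A unit step of the index changes the main term by \<open>c h\<^sup>2\<close>, so for a small mesh
  the increments are strictly monotone in the index (\<open>radial_increment_step_monotone\<close>), and
  \<open>vertex u approaches vertex u + 1\<close> and \<open>vertex u approaches vertex u - 1\<close> are threshold
  conditions on \<open>u\<close>, in opposite directions. Their combination makes the set of sides with equilibria
  contiguous (\<open>sides_with_equilibria_contiguous\<close>): if \<open>c > 0\<close>, every side between two such sides
  has a stable equilibrium, and if \<open>c < 0\<close>, it starts at an unstable vertex.
\<close>


section \<open>Distance from the origin along a segment\<close>

definition approaches :: "'a::real_inner \<Rightarrow> 'a \<Rightarrow> bool" where
  "approaches p q \<longleftrightarrow> p \<bullet> (q - p) < 0"

lemma norm_along_segment:
  fixes p q :: "'a::real_inner"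
  shows "(norm (p + s *\<^sub>R (q - p)))\<^sup>2
           = (norm p)\<^sup>2 + s * (2 * (p \<bullet> (q - p)) + s * (norm (q - p))\<^sup>2)"
proof -
  have "(norm (p + s *\<^sub>R d))\<^sup>2 = (norm p)\<^sup>2 + s * (2 * (p \<bullet> d) + s * (norm d)\<^sup>2)" for d
    unfolding power2_norm_eq_inner
    by (simp add: inner_add_left inner_add_right inner_commute algebra_simps)
  then show ?thesis .
qed

lemma in_segment_from:
  fixes p q :: "'a::real_vector"
  shows "z \<in> closed_segment p q \<longleftrightarrow> (\<exists>s. 0 \<le> s \<and> s \<le> 1 \<and> z = p + s *\<^sub>R (q - p))"
  by (auto simp: in_segment algebra_simps)

text \<open>By \<open>norm_along_segment\<close>, the squared norm along the segment is a quadratic with negative slope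
  at \<open>p\<close>, so it stays below its initial value up to its second crossing of that value.\<close>

lemma approaches_imp_norm_le_near:
  fixes p q :: "'a::real_inner"
  assumes "approaches p q"
  shows "\<exists>\<epsilon>>0. \<forall>z \<in> closed_segment p q. dist z p < \<epsilon> \<longrightarrow> norm z \<le> norm p"
proof -
  define F where "F = p \<bullet> (q - p)"
  define L where "L = norm (q - p)"
  have F: "F < 0" using assms by (simp add: approaches_def F_def)
  have L: "0 < L" using F by (auto simp: L_def F_def)
  show ?thesis
  proof (intro exI[of _ "- 2 * F / L"] conjI ballI impI)
    show "0 < - 2 * F / L" using F L by (simp add: divide_neg_pos)
  next
    fix z assume "z \<in> closed_segment p q" and d: "dist z p < - 2 * F / L"
    then obtain s where s: "0 \<le> s" "z = p + s *\<^sub>R (q - p)" by (auto simp: in_segment_from)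
    have "s * L < - 2 * F / L" using d s by (simp add: dist_norm L_def)
    then have "2 * F + s * L\<^sup>2 \<le> 0" using L by (simp add: field_simps power2_eq_square)
    then have "s * (2 * F + s * L\<^sup>2) \<le> 0" using s(1) by (simp add: mult_nonneg_nonpos)
    then have "(norm z)\<^sup>2 \<le> (norm p)\<^sup>2"
      unfolding s(2) norm_along_segment F_def L_def by simp
    then show "norm z \<le> norm p" by (rule power2_le_imp_le) simp
  qed
qed

text \<open>If the slope at \<open>p\<close> vanished, the quadratic term would still make the norm grow strictly along
  the segment. This is why the strict inequality holds at a local maximum.\<close>

lemma local_max_imp_approaches:
  fixes p q :: "'a::real_inner"
  assumes max: "\<forall>\<^sub>F z in at p within X. norm z \<le> norm p"
    and sub: "closed_segment p q \<subseteq> X" and "p \<noteq> q"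
  shows "approaches p q"
proof -
  define L where "L = norm (q - p)"
  have L: "0 < L" using assms(3) by (simp add: L_def)
  obtain d where d: "0 < d" "\<And>z. z \<in> X \<Longrightarrow> z \<noteq> p \<Longrightarrow> dist z p < d \<Longrightarrow> norm z \<le> norm p"
    using max unfolding eventually_at by blast
  define s where "s = min 1 (d / (2 * L))"
  have s: "0 < s" "s \<le> 1" "s * L < d"
  proof -
    show "0 < s" "s \<le> 1" using d L by (auto simp: s_def)
    have "s * L \<le> d / (2 * L) * L" using L by (intro mult_right_mono) (auto simp: s_def)
    also have "\<dots> < d" using L d by simp
    finally show "s * L < d" .
  qed
  let ?z = "p + s *\<^sub>R (q - p)"
  have "norm ?z \<le> norm p"
    using s assms(3) sub by (intro d(2)) (auto simp: in_segment_from dist_norm L_def)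
  then have "(norm ?z)\<^sup>2 \<le> (norm p)\<^sup>2" by (simp add: power_mono)
  then have "s * (2 * (p \<bullet> (q - p)) + s * L\<^sup>2) \<le> 0"
    unfolding norm_along_segment L_def by simp
  then have "2 * (p \<bullet> (q - p)) + s * L\<^sup>2 \<le> 0" using s(1) by (simp add: mult_le_0_iff)
  moreover have "0 < s * L\<^sup>2" using s L by simp
  ultimately show ?thesis unfolding approaches_def by linarith
qed

lemma ex_foot_of_perpendicular:
  fixes p q :: "'a::real_inner"
  assumes "approaches p q" and "approaches q p"
  shows "\<exists>z \<in> closed_segment p q. z \<bullet> (q - p) = 0"
proof -
  define F where "F = p \<bullet> (q - p)"
  define L where "L = (q - p) \<bullet> (q - p)"
  have F: "F < 0" using assms by (simp add: approaches_def F_def)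
  have "0 < q \<bullet> (q - p)" using assms(2) by (simp add: approaches_def inner_diff_right)
  moreover have "q \<bullet> (q - p) = F + L" by (simp add: F_def L_def inner_diff_left)
  ultimately have L: "0 < F + L" by simp
  show ?thesis
  proof
    show "p + (- F / L) *\<^sub>R (q - p) \<in> closed_segment p q"
      unfolding in_segment_from using F L by (intro exI[of _ "- F / L"]) (auto simp: field_simps)
    show "(p + (- F / L) *\<^sub>R (q - p)) \<bullet> (q - p) = 0"
      unfolding inner_add_left inner_scaleR_left F_def[symmetric] L_def[symmetric]
      using F L by simp
  qed
qed


section \<open>Indices\<close>

lemma mesh_pos: "a < b \<Longrightarrow> 0 < n \<Longrightarrow> 0 < mesh a b n"
  by (simp add: mesh_def)

lemma index_iff:
  assumes "a < b" "0 < n"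
  shows "i \<in> indices a b n \<longleftrightarrow> (\<exists>j\<le>n. i = a / mesh a b n + real j)"
  using mesh_pos[OF assms]
  by (auto simp: indices_def division_points_def field_simps)

lemma finite_indices: "a < b \<Longrightarrow> 0 < n \<Longrightarrow> finite (indices a b n)"
proof -
  assume ab: "a < b" "0 < n"
  have "indices a b n = (\<lambda>j. a / mesh a b n + real j) ` {..n}"
    using index_iff[OF ab] by auto
  then show ?thesis by simp
qed

lemma index_parameter:
  assumes "a < b" "0 < n" "i \<in> indices a b n"
  shows "i * mesh a b n \<in> {a..b}"
proof -
  obtain j where j: "j \<le> n" "i * mesh a b n = a + real j * mesh a b n"
    using assms(3) by (auto simp: indices_def division_points_def)
  have "real j * mesh a b n \<le> real n * mesh a b n"
    using j mesh_pos[OF assms(1,2)] by (intro mult_right_mono) auto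
  then have "real j * mesh a b n \<le> b - a" using assms by (simp add: mesh_def)
  then show ?thesis using j mesh_pos[OF assms(1,2)] by simp
qed

lemma index_less_imp_step:
  assumes "a < b" "0 < n" "i \<in> indices a b n" "j \<in> indices a b n" "i < j"
  shows "i + 1 \<le> j" and "i + 1 \<in> indices a b n" and "j - 1 \<in> indices a b n"
proof -
  obtain k l where kl: "k \<le> n" "l \<le> n" "i = a / mesh a b n + real k" "j = a / mesh a b n + real l"
    using assms by (auto simp: index_iff)
  then have "k < l" using assms(5) by simp
  then show "i + 1 \<le> j" using kl by simp
  show "i + 1 \<in> indices a b n"
    unfolding index_iff[OF assms(1,2)] using kl \<open>k < l\<close> by (intro exI[of _ "Suc k"]) auto
  show "j - 1 \<in> indices a b n"
    unfolding index_iff[OF assms(1,2)] using kl \<open>k < l\<close> by (intro exI[of _ "l - 1"]) auto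
qed

text \<open>The form in which contiguity yields the two bounds of the theorem; when \<open>E\<close> is empty, the bounds
  are taken in the wrong order.\<close>

lemma order_convex_subset_is_interval:
  fixes E I :: "real set"
  assumes "finite E" "E \<subseteq> I"
    and "\<And>i j l. i \<in> E \<Longrightarrow> l \<in> E \<Longrightarrow> j \<in> I \<Longrightarrow> i < j \<Longrightarrow> j < l \<Longrightarrow> j \<in> E"
  shows "\<exists>k K. \<forall>i\<in>I. i \<in> E \<longleftrightarrow> k \<le> i \<and> i \<le> K"
proof (cases "E = {}")
  case True
  then show ?thesis by (intro exI[of _ 1] exI[of _ 0]) auto
next
  case False
  show ?thesis
  proof (intro exI ballI)
    fix i assume i: "i \<in> I"
    have m: "Min E \<in> E" "Max E \<in> E" using False assms(1) by auto
    show "i \<in> E \<longleftrightarrow> Min E \<le> i \<and> i \<le> Max E"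
      using assms(3)[OF m i] m assms(1) by (metis Max_ge Min_le order_le_less)
  qed
qed


section \<open>Equilibria of a polygon inscribed in a graph\<close>

text \<open>An increasing abscissa makes the polygon a graph over the first axis, so that positions on it can be
  compared by abscissa.\<close>

locale inscribed_polygon =
  fixes a b :: real and r :: "real \<Rightarrow> real \<times> real" and n :: nat
  assumes interval: "a < b" and segments: "0 < n"
    and graph: "strict_mono_on {a..b} (\<lambda>t. fst (r t))"
begin

abbreviation "I \<equiv> indices a b n"
abbreviation "p \<equiv> vertex a b r n"

lemma vertex_mono:
  assumes "i \<in> I" "j \<in> I"
  shows "fst (p i) < fst (p j) \<longleftrightarrow> i < j" and "fst (p i) \<le> fst (p j) \<longleftrightarrow> i \<le> j"
proof -
  have m: "0 < mesh a b n" by (rule mesh_pos[OF interval segments])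
  note ij = index_parameter[OF interval segments assms(1)] index_parameter[OF interval segments assms(2)]
  show "fst (p i) < fst (p j) \<longleftrightarrow> i < j"
    using strict_mono_on_less[OF graph ij] m by (simp add: vertex_def)
  show "fst (p i) \<le> fst (p j) \<longleftrightarrow> i \<le> j"
    using strict_mono_on_less_eq[OF graph ij] m by (simp add: vertex_def)
qed

lemma side_abscissa:
  assumes "i \<in> I" "i + 1 \<in> I" "q \<in> side a b r n i"
  shows "fst (p i) \<le> fst q" "fst q \<le> fst (p (i + 1))"
proof -
  obtain s where s: "0 \<le> s" "s \<le> 1" "q = p i + s *\<^sub>R (p (i + 1) - p i)"
    using assms(3) by (auto simp: side_def in_segment_from)
  have d: "0 \<le> fst (p (i + 1)) - fst (p i)" using vertex_mono(2)[OF assms(1,2)] by simp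
  have q: "fst q = fst (p i) + s * (fst (p (i + 1)) - fst (p i))" using s by simp
  show "fst (p i) \<le> fst q" using q s(1) d by simp
  show "fst q \<le> fst (p (i + 1))" using q mult_right_mono[OF s(2) d] by simp
qed

text \<open>A stable equilibrium is orthogonal to its side while neither end point is, so it is not a vertex and
  belongs to no other side.\<close>

lemma stable_equilibrium_abscissa:
  assumes "stable_equilibrium a b r n i q"
  shows "fst (p i) < fst q" "fst q < fst (p (i + 1))"
proof -
  have st: "i \<in> I" "i + 1 \<in> I" "p i \<bullet> (p (i + 1) - p i) < 0" "0 < p (i + 1) \<bullet> (p (i + 1) - p i)"
      "q \<in> side a b r n i" "q \<bullet> (p (i + 1) - p i) = 0"
    using assms by (auto simp: stable_equilibrium_def Let_def)
  obtain s where s: "0 \<le> s" "s \<le> 1" "q = p i + s *\<^sub>R (p (i + 1) - p i)"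
    using st(5) by (auto simp: side_def in_segment_from)
  have "s \<noteq> 0" "s \<noteq> 1" using s st by auto
  then have s01: "0 < s" "s < 1" using s by auto
  have d: "0 < fst (p (i + 1)) - fst (p i)" using vertex_mono(1)[OF st(1,2)] by simp
  have q: "fst q = fst (p i) + s * (fst (p (i + 1)) - fst (p i))" using s by simp
  show "fst (p i) < fst q" using q s01(1) d by simp
  show "fst q < fst (p (i + 1))" using q mult_strict_right_mono[OF s01(2) d] by simp
qed

lemma ex_stable_equilibrium_iff:
  "(\<exists>q. stable_equilibrium a b r n i q) \<longleftrightarrow>
     i \<in> I \<and> i + 1 \<in> I \<and> approaches (p i) (p (i + 1)) \<and> approaches (p (i + 1)) (p i)"
proof -
  have "0 < y \<bullet> (y - x) \<longleftrightarrow> y \<bullet> (x - y) < 0" for x y :: "real \<times> real"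
    by (simp add: inner_diff_right)
  then show ?thesis
    using ex_foot_of_perpendicular[of "p i" "p (i + 1)"]
    unfolding stable_equilibrium_def Let_def approaches_def side_def by blast
qed

text \<open>The unstable equilibria are defined by a neighbourhood in the whole polygon; this reduces them to the
  two adjacent sides.\<close>

lemma polygon_near_vertex:
  assumes "i - 1 \<in> I" "i \<in> I" "i + 1 \<in> I"
  shows "\<exists>\<epsilon>>0. \<forall>z \<in> polygon a b r n. dist z (p i) < \<epsilon> \<longrightarrow>
           z \<in> closed_segment (p i) (p (i + 1)) \<or> z \<in> closed_segment (p i) (p (i - 1))"
proof -
  define \<epsilon> where "\<epsilon> = min (fst (p (i + 1)) - fst (p i)) (fst (p i) - fst (p (i - 1)))"
  have "0 < \<epsilon>"
    using vertex_mono(1)[OF assms(2,3)] vertex_mono(1)[OF assms(1,2)] by (simp add: \<epsilon>_def)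
  moreover have "z \<in> closed_segment (p i) (p (i + 1)) \<or> z \<in> closed_segment (p i) (p (i - 1))"
    if "z \<in> polygon a b r n" "dist z (p i) < \<epsilon>" for z
  proof -
    obtain j where j: "j \<in> I" "j + 1 \<in> I" "z \<in> side a b r n j"
      using \<open>z \<in> polygon a b r n\<close> by (auto simp: polygon_def)
    have "\<bar>fst z - fst (p i)\<bar> < \<epsilon>"
      using dist_fst_le[of z "p i"] that(2) by (simp add: dist_real_def)
    then have "fst (p (i - 1)) < fst z" "fst z < fst (p (i + 1))" by (auto simp: \<epsilon>_def)
    then have "fst (p (i - 1)) < fst (p (j + 1))" "fst (p j) < fst (p (i + 1))"
      using side_abscissa[OF j] by linarith+
    then have ji: "i - 1 < j + 1" "j < i + 1"
      using vertex_mono(1) assms j by auto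
    have "j = i \<or> j = i - 1"
      using index_less_imp_step(1)[OF interval segments assms(1) j(2) ji(1)]
        index_less_imp_step(1)[OF interval segments j(1) assms(3) ji(2)]
        index_less_imp_step(1)[OF interval segments j(1) assms(2)]
      by linarith
    then show ?thesis using j(3) by (auto simp: side_def closed_segment_commute)
  qed
  ultimately show ?thesis by blast
qed

lemma unstable_equilibrium_iff:
  "unstable_equilibrium a b r n i \<longleftrightarrow>
     i - 1 \<in> I \<and> i \<in> I \<and> i + 1 \<in> I \<and> approaches (p i) (p (i + 1)) \<and> approaches (p i) (p (i - 1))"
proof (cases "i - 1 \<in> I \<and> i \<in> I \<and> i + 1 \<in> I")
  case True
  then have idx: "i - 1 \<in> I" "i \<in> I" "i + 1 \<in> I" by auto
  let ?max = "\<forall>\<^sub>F z in at (p i) within polygon a b r n. norm z \<le> norm (p i)"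
  have "?max \<longleftrightarrow> approaches (p i) (p (i + 1)) \<and> approaches (p i) (p (i - 1))"
  proof
    assume max: ?max
    have "side a b r n i \<subseteq> polygon a b r n" "side a b r n (i - 1) \<subseteq> polygon a b r n"
      unfolding polygon_def using idx by (intro UN_upper; simp)+
    then have "closed_segment (p i) (p (i + 1)) \<subseteq> polygon a b r n"
      "closed_segment (p i) (p (i - 1)) \<subseteq> polygon a b r n"
      by (simp_all add: side_def closed_segment_commute)
    moreover have "p i \<noteq> p (i + 1)" "p i \<noteq> p (i - 1)"
      using vertex_mono(1)[OF idx(2,3)] vertex_mono(1)[OF idx(1,2)] by auto
    ultimately show "approaches (p i) (p (i + 1)) \<and> approaches (p i) (p (i - 1))"
      by (intro conjI local_max_imp_approaches[OF max])
  next
    assume ap: "approaches (p i) (p (i + 1)) \<and> approaches (p i) (p (i - 1))"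
    obtain e1 where e1: "0 < e1"
      "\<And>z. z \<in> closed_segment (p i) (p (i + 1)) \<Longrightarrow> dist z (p i) < e1 \<Longrightarrow> norm z \<le> norm (p i)"
      using approaches_imp_norm_le_near[OF conjunct1[OF ap]] by blast
    obtain e2 where e2: "0 < e2"
      "\<And>z. z \<in> closed_segment (p i) (p (i - 1)) \<Longrightarrow> dist z (p i) < e2 \<Longrightarrow> norm z \<le> norm (p i)"
      using approaches_imp_norm_le_near[OF conjunct2[OF ap]] by blast
    obtain e where e: "0 < e" "\<And>z. z \<in> polygon a b r n \<Longrightarrow> dist z (p i) < e \<Longrightarrow>
           z \<in> closed_segment (p i) (p (i + 1)) \<or> z \<in> closed_segment (p i) (p (i - 1))"
      using polygon_near_vertex[OF idx] by blast
    have "norm z \<le> norm (p i)" if "z \<in> polygon a b r n" "dist z (p i) < min e (min e1 e2)" for z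
      using e(2)[of z] e1(2)[of z] e2(2)[of z] that by auto
    then show ?max
      unfolding eventually_at using e(1) e1(1) e2(1) by (intro exI[of _ "min e (min e1 e2)"]) auto
  qed
  then show ?thesis using idx by (simp add: unstable_equilibrium_def)
next
  case False
  then show ?thesis unfolding unstable_equilibrium_def by blast
qed

lemma in_polygon_equilibria_iff:
  "q \<in> polygon_equilibria a b r n \<longleftrightarrow>
     (\<exists>j. stable_equilibrium a b r n j q) \<or> (\<exists>j. q = p j \<and> unstable_equilibrium a b r n j)"
  by (simp only: polygon_equilibria_def Un_iff mem_Collect_eq)

text \<open>A vertex could also be an equilibrium as the stable point of some side or as an unstable vertex with
  another index; the abscissas exclude both.\<close>

lemma vertex_in_equilibria_iff:
  assumes "i \<in> I"
  shows "p i \<in> polygon_equilibria a b r n \<longleftrightarrow> unstable_equilibrium a b r n i"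
proof
  assume "p i \<in> polygon_equilibria a b r n"
  then consider j where "stable_equilibrium a b r n j (p i)"
    | j where "p i = p j" "unstable_equilibrium a b r n j"
    unfolding in_polygon_equilibria_iff by (elim disjE exE conjE)
  then show "unstable_equilibrium a b r n i"
  proof cases
    case 1
    then have j: "j \<in> I" "j + 1 \<in> I" by (auto simp: stable_equilibrium_def Let_def)
    have "j < i" "i < j + 1"
      using stable_equilibrium_abscissa[OF 1] vertex_mono(1)[OF j(1) assms]
        vertex_mono(1)[OF assms j(2)] by simp_all
    then show ?thesis using index_less_imp_step(1)[OF interval segments j(1) assms] by simp
  next
    case 2
    then have "j \<in> I" by (simp add: unstable_equilibrium_def)
    then have "i = j"
      using 2(1) vertex_mono(2)[of i j] vertex_mono(2)[of j i] assms by simp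
    then show ?thesis using 2 by simp
  qed
next
  assume "unstable_equilibrium a b r n i"
  then have "\<exists>j. p i = p j \<and> unstable_equilibrium a b r n j" by (intro exI[of _ i] conjI refl)
  then show "p i \<in> polygon_equilibria a b r n" unfolding in_polygon_equilibria_iff by (rule disjI2)
qed

lemma side_has_equilibrium_iff:
  assumes i: "i \<in> I" "i + 1 \<in> I"
  shows "side a b r n i \<inter> polygon_equilibria a b r n \<noteq> {} \<longleftrightarrow>
     (\<exists>q. stable_equilibrium a b r n i q)
     \<or> unstable_equilibrium a b r n i \<or> unstable_equilibrium a b r n (i + 1)"
    (is "_ \<longleftrightarrow> ?R")
proof
  assume "side a b r n i \<inter> polygon_equilibria a b r n \<noteq> {}"
  then obtain q where q: "q \<in> side a b r n i" "q \<in> polygon_equilibria a b r n" by auto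
  note x = side_abscissa[OF i q(1)]
  consider j where "stable_equilibrium a b r n j q"
    | j where "q = p j" "unstable_equilibrium a b r n j"
    using q(2) unfolding in_polygon_equilibria_iff by (elim disjE exE conjE)
  then show ?R
  proof cases
    case 1
    then have j: "j \<in> I" "j + 1 \<in> I" by (auto simp: stable_equilibrium_def Let_def)
    have "fst (p j) < fst (p (i + 1))" "fst (p i) < fst (p (j + 1))"
      using stable_equilibrium_abscissa[OF 1] x by auto
    then have "j < i + 1" "i < j + 1"
      using vertex_mono(1)[OF j(1) i(2)] vertex_mono(1)[OF i(1) j(2)] by simp_all
    then have "j = i"
      using index_less_imp_step(1)[OF interval segments j(1) i(1)]
        index_less_imp_step(1)[OF interval segments i(1) j(1)] by linarith
    then have "stable_equilibrium a b r n i q" using 1 by simp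
    then show ?thesis by (rule disjI1[OF exI])
  next
    case 2
    then have j: "j \<in> I" by (simp add: unstable_equilibrium_def)
    have "i \<le> j" "j \<le> i + 1"
      using x 2(1) vertex_mono(2)[OF i(1) j] vertex_mono(2)[OF j i(2)] by simp_all
    then have "j = i \<or> j = i + 1"
      using index_less_imp_step(1)[OF interval segments i(1) j] by linarith
    then show ?thesis using 2(2) by (elim disjE) simp_all
  qed
next
  assume ?R
  then obtain q where "q \<in> side a b r n i"
    "(\<exists>j. stable_equilibrium a b r n j q) \<or> (\<exists>j. q = p j \<and> unstable_equilibrium a b r n j)"
  proof (elim disjE exE)
    fix q assume "stable_equilibrium a b r n i q"
    moreover from this have "q \<in> side a b r n i" by (simp add: stable_equilibrium_def Let_def)
    ultimately show ?thesis using that[of q] by blast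
  next
    assume "unstable_equilibrium a b r n i"
    moreover have "p i \<in> side a b r n i" by (simp add: side_def)
    ultimately show ?thesis using that[of "p i"] by blast
  next
    assume "unstable_equilibrium a b r n (i + 1)"
    moreover have "p (i + 1) \<in> side a b r n i" by (simp add: side_def)
    ultimately show ?thesis using that[of "p (i + 1)"] by blast
  qed
  then have "q \<in> side a b r n i \<inter> polygon_equilibria a b r n"
    by (simp only: in_polygon_equilibria_iff Int_iff)
  then show "side a b r n i \<inter> polygon_equilibria a b r n \<noteq> {}" by (rule ex_in_conv[THEN iffD1, OF exI])
qed

end


section \<open>Radial increments of a curve\<close>

text \<open>Polarization splits the increment \<open>x \<bullet> (y - x)\<close>, whose sign decides whether \<open>x\<close> approaches \<open>y\<close>, into the
  change of half the squared norm and half the squared chord. The following estimates treat the two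
  parts separately.\<close>

lemma inner_increment_eq:
  fixes x y :: "'a::real_inner"
  shows "x \<bullet> (y - x) = ((norm y)\<^sup>2 - (norm x)\<^sup>2) / 2 - (norm (y - x))\<^sup>2 / 2"
  unfolding power2_norm_eq_inner by (simp add: inner_diff inner_commute field_simps)

text \<open>The mean value theorem for \<open>\<lambda>t. (norm (r t))\<^sup>2 / 2 - c * t\<^sup>2 / 2\<close>. The case \<open>c = 0\<close> serves the first-order
  estimate; subtracting the quadratic model serves the second-order one.\<close>

lemma half_norm_square_mean_value:
  fixes r v :: "real \<Rightarrow> 'a::real_inner"
  assumes der: "\<And>t. t \<in> {a..b} \<Longrightarrow> (r has_vector_derivative v t) (at t within {a..b})"
    and ts: "t \<in> {a..b}" "s \<in> {a..b}"
  shows "\<exists>\<xi> \<in> closed_segment t s.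
           ((norm (r s))\<^sup>2 - (norm (r t))\<^sup>2) / 2 - c * (s\<^sup>2 - t\<^sup>2) / 2 = (s - t) * (r \<xi> \<bullet> v \<xi> - c * \<xi>)"
proof -
  let ?f = "\<lambda>x. (r x \<bullet> r x) / 2 - c * x\<^sup>2 / 2"
  have *: "\<exists>\<xi> \<in> {t..s}. ?f s - ?f t = (s - t) * (r \<xi> \<bullet> v \<xi> - c * \<xi>)"
    if "t \<le> s" "t \<in> {a..b}" "s \<in> {a..b}" for t s
  proof -
    have "\<exists>\<xi>\<in>{t..s}. ?f s - ?f t = (\<lambda>h. h * (r \<xi> \<bullet> v \<xi> - c * \<xi>)) (s - t)"
    proof (rule mvt_very_simple[OF \<open>t \<le> s\<close>])
      fix x assume x: "t \<le> x" "x \<le> s"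
      have "(r has_vector_derivative v x) (at x within {t..s})"
        by (rule has_vector_derivative_within_subset[OF der]) (use that x in auto)
      then have "(r has_derivative (\<lambda>h. h *\<^sub>R v x)) (at x within {t..s})"
        by (simp add: has_vector_derivative_def)
      then show "(?f has_derivative (\<lambda>h. h * (r x \<bullet> v x - c * x))) (at x within {t..s})"
        by (auto intro!: derivative_eq_intros simp: inner_commute field_simps)
    qed
    then show ?thesis by simp
  qed
  have "\<exists>\<xi> \<in> closed_segment t s. ?f s - ?f t = (s - t) * (r \<xi> \<bullet> v \<xi> - c * \<xi>)"
  proof (cases "t \<le> s")
    case True
    then show ?thesis using *[OF True ts] by (simp add: closed_segment_eq_real_ivl)
  next
    case False
    then have "s \<le> t" by simp
    from *[OF this ts(2,1)] obtain \<xi> where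
      "\<xi> \<in> {s..t}" "?f t - ?f s = (t - s) * (r \<xi> \<bullet> v \<xi> - c * \<xi>)" by auto
    then show ?thesis using False
      by (intro bexI[of _ \<xi>]) (auto simp: closed_segment_eq_real_ivl algebra_simps)
  qed
  then show ?thesis by (simp add: power2_norm_eq_inner diff_divide_distrib right_diff_distrib diff_right_commute algebra_simps)
qed

lemma C1_imp_lipschitz:
  fixes f f' :: "real \<Rightarrow> 'a::real_normed_vector"
  assumes der: "\<And>t. t \<in> {a..b} \<Longrightarrow> (f has_vector_derivative f' t) (at t within {a..b})"
    and cont: "continuous_on {a..b} f'"
  shows "\<exists>L\<ge>0. \<forall>t\<in>{a..b}. \<forall>s\<in>{a..b}. norm (f s - f t) \<le> L * \<bar>s - t\<bar>"
proof -
  have "bounded (f' ` {a..b})"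
    using cont compact_continuous_image compact_imp_bounded compact_Icc by blast
  then obtain L where L: "0 < L" "\<And>t. t \<in> {a..b} \<Longrightarrow> norm (f' t) \<le> L"
    unfolding bounded_pos by auto
  have "norm (f s - f t) \<le> L * \<bar>s - t\<bar>" if "t \<in> {a..b}" "s \<in> {a..b}" for t s
  proof -
    have "norm (f s - f t) \<le> L * norm (s - t)"
    proof (rule differentiable_bound[where S = "{a..b}" and f' = "\<lambda>x h. h *\<^sub>R f' x"])
      show "(f has_derivative (\<lambda>h. h *\<^sub>R f' x)) (at x within {a..b})" if "x \<in> {a..b}" for x
        using der[OF that] by (simp add: has_vector_derivative_def)
      show "onorm (\<lambda>h. h *\<^sub>R f' x) \<le> L" if "x \<in> {a..b}" for x
        using L(2)[OF that] by (intro onorm_bound) (use L(1) in \<open>auto simp: mult.commute[of L] intro: mult_left_mono\<close>)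
    qed (use that in auto)
    then show ?thesis by simp
  qed
  then show ?thesis using L(1) by (intro exI[of _ L]) auto
qed

text \<open>Both parts of the increment are controlled by Lipschitz constants alone, which makes the error
  uniform on the whole interval.\<close>

lemma radial_increment_first_order:
  fixes r v :: "real \<Rightarrow> 'a::real_inner"
  assumes der: "\<And>t. t \<in> {a..b} \<Longrightarrow> (r has_vector_derivative v t) (at t within {a..b})"
    and r_lip: "\<And>t s. t \<in> {a..b} \<Longrightarrow> s \<in> {a..b} \<Longrightarrow> norm (r s - r t) \<le> L * \<bar>s - t\<bar>"
    and q_lip: "\<And>t s. t \<in> {a..b} \<Longrightarrow> s \<in> {a..b} \<Longrightarrow> \<bar>r s \<bullet> v s - r t \<bullet> v t\<bar> \<le> C * \<bar>s - t\<bar>"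
    and ts: "t \<in> {a..b}" "s \<in> {a..b}"
  shows "\<bar>r t \<bullet> (r s - r t) - (s - t) * (r t \<bullet> v t)\<bar> \<le> (\<bar>C\<bar> + L\<^sup>2 / 2) * (s - t)\<^sup>2"
proof -
  obtain \<xi> where \<xi>: "\<xi> \<in> closed_segment t s"
      "((norm (r s))\<^sup>2 - (norm (r t))\<^sup>2) / 2 = (s - t) * (r \<xi> \<bullet> v \<xi>)"
    using half_norm_square_mean_value[OF der ts, of 0] by auto
  have \<xi>ab: "\<xi> \<in> {a..b}" "\<bar>\<xi> - t\<bar> \<le> \<bar>s - t\<bar>"
    using \<xi>(1) ts by (auto simp: closed_segment_eq_real_ivl split: if_splits)
  have "\<bar>r \<xi> \<bullet> v \<xi> - r t \<bullet> v t\<bar> \<le> \<bar>C\<bar> * \<bar>s - t\<bar>"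
    using q_lip[OF ts(1) \<xi>ab(1)] \<xi>ab(2)
    by (meson abs_ge_self abs_ge_zero mult_mono order_trans)
  then have "\<bar>s - t\<bar> * \<bar>r \<xi> \<bullet> v \<xi> - r t \<bullet> v t\<bar> \<le> \<bar>s - t\<bar> * (\<bar>C\<bar> * \<bar>s - t\<bar>)"
    by (simp add: mult_left_mono)
  then have 1: "\<bar>(s - t) * (r \<xi> \<bullet> v \<xi>) - (s - t) * (r t \<bullet> v t)\<bar> \<le> \<bar>C\<bar> * (s - t)\<^sup>2"
    unfolding right_diff_distrib[symmetric] abs_mult
    by (simp add: power2_eq_square mult.left_commute)
  have "(norm (r s - r t))\<^sup>2 \<le> (L * \<bar>s - t\<bar>)\<^sup>2"
    using r_lip[OF ts] by (intro power_mono) auto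
  then have 2: "\<bar>(norm (r s - r t))\<^sup>2 / 2\<bar> \<le> L\<^sup>2 / 2 * (s - t)\<^sup>2"
    by (simp add: power_mult_distrib)
  have "r t \<bullet> (r s - r t) - (s - t) * (r t \<bullet> v t)
      = ((s - t) * (r \<xi> \<bullet> v \<xi>) - (s - t) * (r t \<bullet> v t)) - (norm (r s - r t))\<^sup>2 / 2"
    using \<xi>(2) inner_increment_eq[of "r t" "r s"] by simp
  then have "\<bar>r t \<bullet> (r s - r t) - (s - t) * (r t \<bullet> v t)\<bar> \<le> \<bar>C\<bar> * (s - t)\<^sup>2 + L\<^sup>2 / 2 * (s - t)\<^sup>2"
    using 1 2 by linarith
  then show ?thesis by (simp add: algebra_simps)
qed

text \<open>The quotient \<open>f t / t\<close>, with the value \<open>c\<close> at \<open>0\<close>, is continuous and has no zero on a compact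
  interval.\<close>

lemma nonvanishing_imp_linear_lower_bound:
  fixes f :: "real \<Rightarrow> real"
  assumes cont: "continuous_on {a..b} f"
    and der: "(f has_real_derivative c) (at 0 within {a..b})" and "c \<noteq> 0" "f 0 = 0"
    and nz: "\<And>t. t \<in> {a..b} \<Longrightarrow> f t = 0 \<Longrightarrow> t = 0"
  shows "\<exists>m>0. \<forall>t\<in>{a..b}. m * \<bar>t\<bar> \<le> \<bar>f t\<bar>"
proof (cases "{a..b} = {}")
  case True
  then show ?thesis by (intro exI[of _ 1]) auto
next
  case False
  define h where "h t = (if t = 0 then c else f t / t)" for t
  have "continuous (at t within {a..b}) h" if t: "t \<in> {a..b}" for t
  proof (cases "t = 0")
    case True
    have "((\<lambda>y. (f y - f 0) / (y - 0)) \<longlongrightarrow> c) (at 0 within {a..b})"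
      using der by (simp add: has_field_derivative_iff)
    then have "(h \<longlongrightarrow> c) (at 0 within {a..b})"
      by (rule Lim_transform_eventually) (auto simp: eventually_at h_def \<open>f 0 = 0\<close> intro!: exI[of _ 1])
    then show ?thesis by (simp add: True continuous_within h_def)
  next
    case nt: False
    have "((\<lambda>t. f t / t) \<longlongrightarrow> f t / t) (at t within {a..b})"
      using cont t nt by (intro tendsto_intros) (auto simp: continuous_on_def)
    then have "(h \<longlongrightarrow> f t / t) (at t within {a..b})"
      by (rule Lim_transform_eventually)
        (use nt in \<open>auto simp: eventually_at h_def dist_real_def intro!: exI[of _ "\<bar>t\<bar>"]\<close>)
    then show ?thesis using nt by (simp add: continuous_within h_def)
  qed
  then have "continuous_on {a..b} (\<lambda>t. \<bar>h t\<bar>)"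
    by (simp add: continuous_on_eq_continuous_within continuous_intros)
  then obtain x where x: "x \<in> {a..b}" "\<And>t. t \<in> {a..b} \<Longrightarrow> \<bar>h x\<bar> \<le> \<bar>h t\<bar>"
    using continuous_attains_inf[OF compact_Icc False] by blast
  have "h x \<noteq> 0" using nz[OF x(1)] \<open>c \<noteq> 0\<close> by (auto simp: h_def)
  moreover have "\<bar>h x\<bar> * \<bar>t\<bar> \<le> \<bar>f t\<bar>" if t: "t \<in> {a..b}" for t
  proof (cases "t = 0")
    case False
    have "\<bar>h x\<bar> * \<bar>t\<bar> \<le> \<bar>h t\<bar> * \<bar>t\<bar>" using x(2)[OF t] by (intro mult_right_mono) auto
    also have "\<dots> = \<bar>f t\<bar>" using False by (simp add: h_def)
    finally show ?thesis .
  qed simp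
  ultimately show ?thesis by (intro exI[of _ "\<bar>h x\<bar>"]) auto
qed

text \<open>The change of half the squared norm is \<open>c * (t * h + h\<^sup>2 / 2)\<close> up to a small multiple of \<open>h\<^sup>2\<close>, since
  \<open>r t \<bullet> v t\<close> is \<open>c * t\<close> to first order; the squared chord is \<open>(norm (v 0))\<^sup>2 * h\<^sup>2\<close> up to such an
  error by continuity of \<open>v\<close>. The step \<open>h\<close> may have either sign, so forward and backward
  increments are covered together.\<close>

lemma radial_increment_second_order:
  fixes r v :: "real \<Rightarrow> 'a::real_inner"
  assumes ab: "a < 0" "0 < b"
    and der: "\<And>t. t \<in> {a..b} \<Longrightarrow> (r has_vector_derivative v t) (at t within {a..b})"
    and vcont: "continuous_on {a..b} v"
    and q0: "r 0 \<bullet> v 0 = 0"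
    and qder: "((\<lambda>t. r t \<bullet> v t) has_real_derivative c) (at 0 within {a..b})"
    and N: "0 \<le> N" and \<eta>: "0 < \<eta>"
  shows "\<exists>\<delta>>0. \<forall>t h. \<bar>h\<bar> < \<delta> \<and> \<bar>t\<bar> \<le> N * \<bar>h\<bar> \<longrightarrow>
     \<bar>r t \<bullet> (r (t + h) - r t) - (c * t * h + (c - (norm (v 0))\<^sup>2) / 2 * h\<^sup>2)\<bar> \<le> \<eta> * h\<^sup>2"
proof -
  define V where "V = norm (v 0)"
  \<comment> \<open>\<open>e1\<close> bounds the relative error of \<open>r t \<bullet> v t\<close> and \<open>e2\<close> the variation of \<open>v\<close>; each
    contributes at most \<open>\<eta> / 2 * h\<^sup>2\<close> to the final error.\<close>
  define e1 where "e1 = \<eta> / (2 * (N + 1))"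
  define e2 where "e2 = min 1 (\<eta> / (2 * V + 1))"
  have V: "0 \<le> V" by (simp add: V_def)
  have e: "0 < e1" "0 < e2" using N \<eta> V by (auto simp: e1_def e2_def)
  have z: "0 \<in> {a..b}" using ab by simp
  have qd: "((\<lambda>t. r t \<bullet> v t) has_derivative (\<lambda>h. c * h)) (at 0 within {a..b})"
    using qder by (simp add: has_field_derivative_def)
  obtain d1 where d1: "0 < d1"
    "\<And>x. x \<in> {a..b} \<Longrightarrow> \<bar>x\<bar> < d1 \<Longrightarrow> \<bar>r x \<bullet> v x - c * x\<bar> \<le> e1 * \<bar>x\<bar>"
    using qd[unfolded has_derivative_within_alt] e(1) q0 by fastforce
  obtain d2 where d2: "0 < d2" "\<And>x. x \<in> {a..b} \<Longrightarrow> \<bar>x\<bar> < d2 \<Longrightarrow> norm (v x - v 0) < e2"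
    using vcont[unfolded continuous_on_iff] z e(2) by (fastforce simp: dist_norm)
  define d where "d = min (min d1 d2) (min (-a) b)"
  have d: "0 < d" using d1 d2 ab by (simp add: d_def)
  have din: "x \<in> {a..b}" "\<bar>x\<bar> < d1" "\<bar>x\<bar> < d2" if "\<bar>x\<bar> < d" for x
    using that by (auto simp: d_def)
  show ?thesis
  proof (intro exI[of _ "d / (N + 1)"] conjI allI impI)
    show "0 < d / (N + 1)" using d N by simp
  next
    fix t h assume th: "\<bar>h\<bar> < d / (N + 1) \<and> \<bar>t\<bar> \<le> N * \<bar>h\<bar>"
    have Nh: "(N + 1) * \<bar>h\<bar> < d" using th N by (simp add: field_simps)
    have near: "\<bar>x\<bar> \<le> (N + 1) * \<bar>h\<bar>" "\<bar>x\<bar> < d" if "x \<in> closed_segment t (t + h)" for x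
    proof -
      have "\<bar>x\<bar> \<le> \<bar>t\<bar> + \<bar>h\<bar>"
        using that by (auto simp: closed_segment_eq_real_ivl split: if_splits)
      then show "\<bar>x\<bar> \<le> (N + 1) * \<bar>h\<bar>" using th by (simp add: algebra_simps)
      then show "\<bar>x\<bar> < d" using Nh by simp
    qed
    have sub: "closed_segment t (t + h) \<subseteq> {a..b}" using near din by blast
    define \<Delta> where "\<Delta> = r (t + h) - r t"
    \<comment> \<open>The change of half the squared norm, up to a quadratic model with the second derivative \<open>c\<close>.\<close>
    have tt: "t \<in> {a..b}" "t + h \<in> {a..b}" using sub by auto
    have "\<exists>x \<in> closed_segment t (t + h).
        ((norm (r (t + h)))\<^sup>2 - (norm (r t))\<^sup>2) / 2 - c * ((t + h)\<^sup>2 - t\<^sup>2) / 2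
          = h * (r x \<bullet> v x - c * x)"
      using half_norm_square_mean_value[OF der tt, of c] by simp
    then obtain x where x: "x \<in> closed_segment t (t + h)"
      "((norm (r (t + h)))\<^sup>2 - (norm (r t))\<^sup>2) / 2 - c * ((t + h)\<^sup>2 - t\<^sup>2) / 2
          = h * (r x \<bullet> v x - c * x)" by blast
    have "\<bar>r x \<bullet> v x - c * x\<bar> \<le> e1 * \<bar>x\<bar>" using d1(2) din near(2)[OF x(1)] by blast
    also have "\<dots> \<le> e1 * ((N + 1) * \<bar>h\<bar>)" using near(1)[OF x(1)] e by simp
    also have "\<dots> = \<eta> / 2 * \<bar>h\<bar>" using N by (simp add: e1_def field_simps)
    finally have "\<bar>h\<bar> * \<bar>r x \<bullet> v x - c * x\<bar> \<le> \<bar>h\<bar> * (\<eta> / 2 * \<bar>h\<bar>)"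
      by (rule mult_left_mono) simp
    then have A: "\<bar>((norm (r (t + h)))\<^sup>2 - (norm (r t))\<^sup>2) / 2 - c * ((t + h)\<^sup>2 - t\<^sup>2) / 2\<bar> \<le> (\<eta> * h\<^sup>2) / 2"
      unfolding x(2) abs_mult by (simp add: power2_eq_square mult.left_commute)
    have sum_bound: "\<bar>X - Y / 2\<bar> \<le> E" if "\<bar>X\<bar> \<le> E / 2" "\<bar>Y\<bar> \<le> E" for X Y E :: real
      using that by linarith
    have chord: "norm (\<Delta> - h *\<^sub>R v 0) \<le> e2 * \<bar>h\<bar>"
    proof -
      have "norm (\<Delta> - (t + h - t) *\<^sub>R v 0) \<le> norm (t + h - t) * e2" unfolding \<Delta>_def
      proof (rule vector_differentiable_bound_linearization[where S = "{-d<..<d}" and ?x0.0 = 0 and f' = v])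
        have S: "x \<in> {a..b}" "\<bar>x\<bar> < d2" if "x \<in> {-d<..<d}" for x
          using din[of x] that by auto
        show "norm (v x - v 0) \<le> e2" if "x \<in> {-d<..<d}" for x
          using d2(2) S[OF that] by (simp add: less_imp_le)
        show "(r has_vector_derivative v x) (at x within {-d<..<d})" if "x \<in> {-d<..<d}" for x
          by (rule has_vector_derivative_within_subset[OF der[OF S(1)[OF that]]]) (use S in auto)
        show "closed_segment t (t + h) \<subseteq> {-d<..<d}"
          by (rule subsetI) (use near(2) in \<open>simp add: abs_less_iff minus_less_iff\<close>)
      qed (use d in auto)
      then show ?thesis by (simp add: mult.commute)
    qed
    have "\<bar>norm \<Delta> - \<bar>h\<bar> * V\<bar> \<le> e2 * \<bar>h\<bar>"
      using norm_triangle_ineq3[of \<Delta> "h *\<^sub>R v 0"] chord by (simp add: V_def)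
    moreover from this have "norm \<Delta> + \<bar>h\<bar> * V \<le> (2 * V + 1) * \<bar>h\<bar>"
      using mult_right_mono[of e2 1 "\<bar>h\<bar>"] by (simp add: e2_def algebra_simps)
    ultimately have "\<bar>norm \<Delta> - \<bar>h\<bar> * V\<bar> * (norm \<Delta> + \<bar>h\<bar> * V) \<le> (e2 * \<bar>h\<bar>) * ((2 * V + 1) * \<bar>h\<bar>)"
      using V e by (intro mult_mono) auto
    also have "\<dots> = (e2 * (2 * V + 1)) * h\<^sup>2" by (simp add: power2_eq_square)
    also have "\<dots> \<le> \<eta> * h\<^sup>2"
    proof (rule mult_right_mono)
      have "e2 * (2 * V + 1) \<le> \<eta> / (2 * V + 1) * (2 * V + 1)"
        using V by (intro mult_right_mono) (auto simp: e2_def)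
      then show "e2 * (2 * V + 1) \<le> \<eta>" using V by simp
    qed simp
    also have "\<bar>norm \<Delta> - \<bar>h\<bar> * V\<bar> * (norm \<Delta> + \<bar>h\<bar> * V) = \<bar>(norm \<Delta> - \<bar>h\<bar> * V) * (norm \<Delta> + \<bar>h\<bar> * V)\<bar>"
      using V by (simp add: abs_mult)
    also have "(norm \<Delta> - \<bar>h\<bar> * V) * (norm \<Delta> + \<bar>h\<bar> * V) = (norm \<Delta>)\<^sup>2 - V\<^sup>2 * h\<^sup>2"
      by (simp add: power2_eq_square algebra_simps)
    finally have B: "\<bar>(norm \<Delta>)\<^sup>2 - V\<^sup>2 * h\<^sup>2\<bar> \<le> \<eta> * h\<^sup>2" .
    have "r t \<bullet> (r (t + h) - r t) - (c * t * h + (c - V\<^sup>2) / 2 * h\<^sup>2)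
        = (((norm (r (t + h)))\<^sup>2 - (norm (r t))\<^sup>2) / 2 - c * ((t + h)\<^sup>2 - t\<^sup>2) / 2)
          - ((norm \<Delta>)\<^sup>2 - V\<^sup>2 * h\<^sup>2) / 2"
      unfolding inner_increment_eq[of "r t"] \<Delta>_def
      by (simp add: field_simps power2_eq_square)
    then show "\<bar>r t \<bullet> (r (t + h) - r t) - (c * t * h + (c - (norm (v 0))\<^sup>2) / 2 * h\<^sup>2)\<bar> \<le> \<eta> * h\<^sup>2"
      unfolding V_def[symmetric] using sum_bound[OF A B] by simp
  qed
qed

text \<open>The main terms of the increments at \<open>w * h\<close> and \<open>u * h\<close> differ by \<open>c * (w - u) * h\<^sup>2\<close>, of size at
  least \<open>\<bar>c\<bar> * h\<^sup>2\<close>. An error of \<open>\<bar>c\<bar> / 4 * h\<^sup>2\<close> in each of them cannot change the sign. Multiplying by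
  \<open>c\<close> states the two directions of monotonicity at once.\<close>

lemma radial_increment_step_monotone:
  fixes r v :: "real \<Rightarrow> 'a::real_inner"
  assumes ab: "a < 0" "0 < b"
    and der: "\<And>t. t \<in> {a..b} \<Longrightarrow> (r has_vector_derivative v t) (at t within {a..b})"
    and vcont: "continuous_on {a..b} v"
    and q0: "r 0 \<bullet> v 0 = 0"
    and qder: "((\<lambda>t. r t \<bullet> v t) has_real_derivative c) (at 0 within {a..b})"
    and c: "c \<noteq> 0" and N: "0 \<le> N"
  shows "\<exists>\<delta>>0. \<forall>h u w. 0 < h \<and> h < \<delta> \<and> \<bar>u\<bar> \<le> N \<and> \<bar>w\<bar> \<le> N \<and> u + 1 \<le> w \<longrightarrow>
     0 < c * (r (w * h) \<bullet> (r (w * h + h) - r (w * h)) - r (u * h) \<bullet> (r (u * h + h) - r (u * h)))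
   \<and> 0 < c * (r (u * h) \<bullet> (r (u * h - h) - r (u * h)) - r (w * h) \<bullet> (r (w * h - h) - r (w * h)))"
proof -
  define k where "k = (c - (norm (v 0))\<^sup>2) / 2"
  obtain \<delta> where \<delta>: "0 < \<delta>" "\<And>t h. \<bar>h\<bar> < \<delta> \<Longrightarrow> \<bar>t\<bar> \<le> N * \<bar>h\<bar> \<Longrightarrow>
     \<bar>r t \<bullet> (r (t + h) - r t) - (c * t * h + k * h\<^sup>2)\<bar> \<le> \<bar>c\<bar> / 4 * h\<^sup>2"
    using radial_increment_second_order[OF ab der vcont q0 qder N, of "\<bar>c\<bar> / 4"] c
    unfolding k_def by auto
  have gap: "0 < c * (X - Y)"
    if "\<bar>X - (c * y + l)\<bar> \<le> \<bar>c\<bar> / 4 * z" "\<bar>Y - (c * x + l)\<bar> \<le> \<bar>c\<bar> / 4 * z" "z \<le> y - x" "0 < z"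
    for X Y x y z l
  proof (cases "0 < c")
    case True
    have "c * z \<le> c * (y - x)" using True that(3) by simp
    then have "c * z / 2 \<le> X - Y" using that(1,2) unfolding right_diff_distrib abs_of_pos[OF True] by linarith
    moreover have "0 < c * z" using True that(4) by simp
    ultimately show ?thesis using True by simp
  next
    case False
    then have c: "c < 0" using c by simp
    have "c * (y - x) \<le> c * z" using c that(3) by simp
    then have "X - Y \<le> c * z / 2" using that(1,2) unfolding right_diff_distrib abs_of_neg[OF c] by linarith
    moreover have "c * z < 0" using c that(4) by (simp add: mult_neg_pos)
    ultimately show ?thesis using c by (simp add: mult_neg_neg)
  qed
  show ?thesis
  proof (intro exI[of _ \<delta>] conjI allI impI)
    fix h u w assume as: "0 < h \<and> h < \<delta> \<and> \<bar>u\<bar> \<le> N \<and> \<bar>w\<bar> \<le> N \<and> u + 1 \<le> w"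
    have bd: "\<bar>u * h\<bar> \<le> N * h" "\<bar>w * h\<bar> \<le> N * h" using as by (auto simp: abs_mult mult_right_mono)
    have z: "h\<^sup>2 \<le> w * h * h - u * h * h" "0 < h\<^sup>2"
      using as mult_right_mono[of 1 "w - u" "h * h"] by (auto simp: power2_eq_square algebra_simps)
    show "0 < c * (r (w * h) \<bullet> (r (w * h + h) - r (w * h)) - r (u * h) \<bullet> (r (u * h + h) - r (u * h)))"
      by (rule gap[of _ "w * h * h" "k * h\<^sup>2" "h\<^sup>2" _ "u * h * h"])
        (use \<delta>(2)[of h "w * h"] \<delta>(2)[of h "u * h"] as bd z in \<open>auto simp: mult.assoc\<close>)
    show "0 < c * (r (u * h) \<bullet> (r (u * h - h) - r (u * h)) - r (w * h) \<bullet> (r (w * h - h) - r (w * h)))"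
      by (rule gap[of _ "- (u * h * h)" "k * h\<^sup>2" "h\<^sup>2" _ "- (w * h * h)"])
        (use \<delta>(2)[of "-h" "w * h"] \<delta>(2)[of "-h" "u * h"] as bd z in \<open>auto simp: mult.assoc\<close>)
  qed (rule \<delta>(1))
qed

text \<open>Approaching a point ahead bounds \<open>r t \<bullet> v t\<close> from above by a multiple of \<open>h\<close>, approaching a point behind
  bounds \<open>r s \<bullet> v s\<close> from below. Taking \<open>s = t\<close> covers the unstable vertices and \<open>s = t + h\<close> the end points
  of a side with a stable equilibrium.\<close>

lemma two_sided_approach_only_near_0:
  fixes r v :: "real \<Rightarrow> 'a::real_inner"
  assumes der: "\<And>t. t \<in> {a..b} \<Longrightarrow> (r has_vector_derivative v t) (at t within {a..b})"
    and r_lip: "\<And>t s. t \<in> {a..b} \<Longrightarrow> s \<in> {a..b} \<Longrightarrow> norm (r s - r t) \<le> L * \<bar>s - t\<bar>"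
    and q_lip: "\<And>t s. t \<in> {a..b} \<Longrightarrow> s \<in> {a..b} \<Longrightarrow> \<bar>r s \<bullet> v s - r t \<bullet> v t\<bar> \<le> C * \<bar>s - t\<bar>"
    and m: "0 < m" "\<And>t. t \<in> {a..b} \<Longrightarrow> m * \<bar>t\<bar> \<le> \<bar>r t \<bullet> v t\<bar>"
  shows "\<exists>M\<ge>0. \<forall>t s h. 0 < h \<and> {t, t + h, s, s - h} \<subseteq> {a..b} \<and> \<bar>s - t\<bar> \<le> h
           \<and> approaches (r t) (r (t + h)) \<and> approaches (r s) (r (s - h)) \<longrightarrow> \<bar>t\<bar> \<le> M * h"
proof -
  define K where "K = \<bar>C\<bar> + L\<^sup>2 / 2"
  have K: "0 \<le> K" by (simp add: K_def)
  have inc: "\<bar>r t \<bullet> (r s - r t) - (s - t) * (r t \<bullet> v t)\<bar> \<le> K * (s - t)\<^sup>2"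
    if "t \<in> {a..b}" "s \<in> {a..b}" for t s
    unfolding K_def by (rule radial_increment_first_order[OF der r_lip q_lip that])
  show ?thesis
  proof (intro exI[of _ "(K + \<bar>C\<bar>) / m"] conjI allI impI)
    show "0 \<le> (K + \<bar>C\<bar>) / m" using K m by simp
  next
    fix t s h
    assume "0 < h \<and> {t, t + h, s, s - h} \<subseteq> {a..b} \<and> \<bar>s - t\<bar> \<le> h
           \<and> approaches (r t) (r (t + h)) \<and> approaches (r s) (r (s - h))"
    then have h: "0 < h" and ts: "t \<in> {a..b}" "t + h \<in> {a..b}" "s \<in> {a..b}" "s - h \<in> {a..b}"
      and st: "\<bar>s - t\<bar> \<le> h"
      and ap: "r t \<bullet> (r (t + h) - r t) < 0" "r s \<bullet> (r (s - h) - r s) < 0"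
      unfolding approaches_def by blast+
    have "h * (r t \<bullet> v t) < K * h\<^sup>2" using inc[OF ts(1,2)] ap(1) by simp
    then have up: "r t \<bullet> v t \<le> K * h" using h by (simp add: power2_eq_square)
    have "- (h * (r s \<bullet> v s)) < K * h\<^sup>2" using inc[OF ts(3,4)] ap(2) by simp
    then have "h * - (r s \<bullet> v s) < h * (K * h)" by (simp add: power2_eq_square mult.left_commute)
    then have low: "- (K * h) \<le> r s \<bullet> v s" using h by (simp only: mult_less_cancel_left_pos)
    have "\<bar>r s \<bullet> v s - r t \<bullet> v t\<bar> \<le> \<bar>C\<bar> * h"
      using q_lip[OF ts(1,3)] st by (meson abs_ge_self abs_ge_zero mult_mono order_trans)
    then have "\<bar>r t \<bullet> v t\<bar> \<le> (K + \<bar>C\<bar>) * h"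
      using up low mult_nonneg_nonneg[of "\<bar>C\<bar>" h] h by (simp add: algebra_simps abs_le_iff)
    then have "m * \<bar>t\<bar> \<le> (K + \<bar>C\<bar>) * h" using m(2)[OF ts(1)] by simp
    then show "\<bar>t\<bar> \<le> (K + \<bar>C\<bar>) / m * h" using m(1) by (simp add: field_simps)
  qed
qed


section \<open>Contiguity of the sides with equilibria\<close>

context inscribed_polygon
begin

lemma parameters:
  assumes "i \<in> I"
  shows "i * mesh a b n \<in> {a..b}"
    and "i + 1 \<in> I \<Longrightarrow> i * mesh a b n + mesh a b n \<in> {a..b}"
    and "i - 1 \<in> I \<Longrightarrow> i * mesh a b n - mesh a b n \<in> {a..b}"
  using index_parameter[OF interval segments assms]
    index_parameter[OF interval segments, of "i + 1"] index_parameter[OF interval segments, of "i - 1"]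
  by (simp_all add: algebra_simps)

lemma vertex_step:
  "p (i + 1) = r (i * mesh a b n + mesh a b n)" "p (i - 1) = r (i * mesh a b n - mesh a b n)"
  by (simp_all add: vertex_def algebra_simps)

lemma unstable_index_bound:
  assumes M: "\<And>t s h. 0 < h \<and> {t, t + h, s, s - h} \<subseteq> {a..b} \<and> \<bar>s - t\<bar> \<le> h
           \<and> approaches (r t) (r (t + h)) \<and> approaches (r s) (r (s - h)) \<Longrightarrow> \<bar>t\<bar> \<le> M * h"
    and u: "unstable_equilibrium a b r n i"
  shows "\<bar>i\<bar> \<le> M"
proof -
  have h: "0 < mesh a b n" by (rule mesh_pos[OF interval segments])
  have idx: "i \<in> I" "i + 1 \<in> I" "i - 1 \<in> I"
    and ap: "approaches (p i) (p (i + 1))" "approaches (p i) (p (i - 1))"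
    using u unfolding unstable_equilibrium_iff by blast+
  have "\<bar>i * mesh a b n\<bar> \<le> M * mesh a b n"
    by (rule M[where s = "i * mesh a b n"])
      (use h parameters[OF idx(1)] idx ap in \<open>simp add: vertex_step vertex_def[of a b r n i]\<close>)
  then show ?thesis using h by (simp add: abs_mult)
qed

lemma stable_index_bound:
  assumes M: "\<And>t s h. 0 < h \<and> {t, t + h, s, s - h} \<subseteq> {a..b} \<and> \<bar>s - t\<bar> \<le> h
           \<and> approaches (r t) (r (t + h)) \<and> approaches (r s) (r (s - h)) \<Longrightarrow> \<bar>t\<bar> \<le> M * h"
    and st: "stable_equilibrium a b r n i q"
  shows "\<bar>i\<bar> \<le> M"
proof -
  have h: "0 < mesh a b n" by (rule mesh_pos[OF interval segments])
  have idx: "i \<in> I" "i + 1 \<in> I"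
    and ap: "approaches (p i) (p (i + 1))" "approaches (p (i + 1)) (p i)"
    using st ex_stable_equilibrium_iff[of i] by blast+
  have "\<bar>i * mesh a b n\<bar> \<le> M * mesh a b n"
    by (rule M[where s = "i * mesh a b n + mesh a b n"])
      (use h parameters[OF idx(1)] idx ap in \<open>simp add: vertex_step vertex_def[of a b r n i]\<close>)
  then show ?thesis using h by (simp add: abs_mult)
qed

text \<open>For \<open>c > 0\<close> forward approach is inherited by smaller indices and backward approach by larger ones, so the
  end points of the side \<open>j\<close> approach each other. For \<open>c < 0\<close> it is the other way round, and vertex
  \<open>j\<close> approaches both neighbours, which exist because \<open>j\<close> lies strictly between two indices. The
  bound \<open>M + 2\<close> leaves room for the end points: a side with an unstable vertex has an index of
  absolute value at most \<open>M + 1\<close>, and its other end point is one further.\<close>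

lemma sides_with_equilibria_contiguous:
  assumes c: "c \<noteq> 0"
    and mono: "\<And>u w. \<bar>u\<bar> \<le> M + 2 \<Longrightarrow> \<bar>w\<bar> \<le> M + 2 \<Longrightarrow> u + 1 \<le> w \<Longrightarrow>
       0 < c * (p w \<bullet> (p (w + 1) - p w) - p u \<bullet> (p (u + 1) - p u))
     \<and> 0 < c * (p u \<bullet> (p (u - 1) - p u) - p w \<bullet> (p (w - 1) - p w))"
    and bound: "\<And>i. unstable_equilibrium a b r n i \<Longrightarrow> \<bar>i\<bar> \<le> M"
      "\<And>i q. stable_equilibrium a b r n i q \<Longrightarrow> \<bar>i\<bar> \<le> M"
    and idx: "i \<in> I" "i + 1 \<in> I" "j \<in> I" "j + 1 \<in> I" "l \<in> I" "l + 1 \<in> I" and "i < j" "j < l"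
    and eq: "side a b r n i \<inter> polygon_equilibria a b r n \<noteq> {}"
      "side a b r n l \<inter> polygon_equilibria a b r n \<noteq> {}"
  shows "side a b r n j \<inter> polygon_equilibria a b r n \<noteq> {}"
proof -
  define A where "A u \<longleftrightarrow> approaches (p u) (p (u + 1))" for u
  define B where "B u \<longleftrightarrow> approaches (p u) (p (u - 1))" for u
  have ij: "i + 1 \<le> j" and jl: "j + 1 \<le> l" and j1: "j - 1 \<in> I"
    using index_less_imp_step[OF interval segments] idx \<open>i < j\<close> \<open>j < l\<close> by auto
  have S: "(\<exists>q. stable_equilibrium a b r n u q) \<longleftrightarrow> u \<in> I \<and> u + 1 \<in> I \<and> A u \<and> B (u + 1)" for u
    by (simp only: ex_stable_equilibrium_iff A_def B_def add_diff_cancel_right')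
  have U: "unstable_equilibrium a b r n u \<longleftrightarrow> u - 1 \<in> I \<and> u \<in> I \<and> u + 1 \<in> I \<and> A u \<and> B u" for u
    by (simp add: unstable_equilibrium_iff A_def B_def)
  \<comment> \<open>Either kind of equilibrium has a forward and a backward approach at an end point of its side;
    only the position of these end points varies.\<close>
  have E: "(A u \<or> A (u + 1)) \<and> (B u \<or> B (u + 1)) \<and> \<bar>u\<bar> \<le> M + 1"
    if u: "u \<in> I" "u + 1 \<in> I" "side a b r n u \<inter> polygon_equilibria a b r n \<noteq> {}" for u
  proof -
    consider "\<exists>q. stable_equilibrium a b r n u q" | "unstable_equilibrium a b r n u"
      | "unstable_equilibrium a b r n (u + 1)"
      using side_has_equilibrium_iff[OF u(1,2)] u(3) by blast
    then show ?thesis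
    proof cases
      case 1
      then have "\<bar>u\<bar> \<le> M" using bound(2) by blast
      then show ?thesis using 1 unfolding S by simp
    next
      case 2
      then have "\<bar>u\<bar> \<le> M" using bound(1) by blast
      then show ?thesis using 2 unfolding U by simp
    next
      case 3
      then have "\<bar>u + 1\<bar> \<le> M" using bound(1) by blast
      then show ?thesis using 3 unfolding U by simp
    qed
  qed
  note Ei = E[OF idx(1,2) eq(1)] and El = E[OF idx(5,6) eq(2)]
  have rng: "\<bar>u\<bar> \<le> M + 2" if "i \<le> u" "u \<le> l + 1" for u
    using that Ei El by auto
  show ?thesis
  proof (cases "0 < c")
    case True
    have dA: "A u" if "A w" "i \<le> u" "u + 1 \<le> w" "w \<le> l + 1" for u w
    proof -
      have "0 < c * (p w \<bullet> (p (w + 1) - p w) - p u \<bullet> (p (u + 1) - p u))"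
        using mono[of u w] rng[of u] rng[of w] that by auto
      then show ?thesis using True \<open>A w\<close> by (simp add: A_def approaches_def zero_less_mult_iff)
    qed
    have dB: "B w" if "B u" "i \<le> u" "u + 1 \<le> w" "w \<le> l + 1" for u w
    proof -
      have "0 < c * (p u \<bullet> (p (u - 1) - p u) - p w \<bullet> (p (w - 1) - p w))"
        using mono[of u w] rng[of u] rng[of w] that by auto
      then show ?thesis using True \<open>B u\<close> by (simp add: B_def approaches_def zero_less_mult_iff)
    qed
    have "A j" using El dA[of l j] dA[of "l + 1" j] ij jl by auto
    moreover have "B (j + 1)" using Ei dB[of i "j + 1"] dB[of "i + 1" "j + 1"] ij jl by auto
    ultimately have "\<exists>q. stable_equilibrium a b r n j q" using S idx by blast
    then show ?thesis using side_has_equilibrium_iff[OF idx(3,4)] by blast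
  next
    case False
    then have c: "c < 0" using c by simp
    have dA: "A w" if "A u" "i \<le> u" "u + 1 \<le> w" "w \<le> l + 1" for u w
    proof -
      have "0 < c * (p w \<bullet> (p (w + 1) - p w) - p u \<bullet> (p (u + 1) - p u))"
        using mono[of u w] rng[of u] rng[of w] that by auto
      then show ?thesis using c \<open>A u\<close> by (simp add: A_def approaches_def zero_less_mult_iff)
    qed
    have dB: "B u" if "B w" "i \<le> u" "u + 1 \<le> w" "w \<le> l + 1" for u w
    proof -
      have "0 < c * (p u \<bullet> (p (u - 1) - p u) - p w \<bullet> (p (w - 1) - p w))"
        using mono[of u w] rng[of u] rng[of w] that by auto
      then show ?thesis using c \<open>B w\<close> by (simp add: B_def approaches_def zero_less_mult_iff)
    qed
    have "A (i + 1)" using Ei dA[of i "i + 1"] ij jl by auto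
    then have "A j" using dA[of "i + 1" j] ij jl index_less_imp_step(1)[OF interval segments idx(2,3)]
      by (cases "i + 1 = j") auto
    have "B l" using El dB[of "l + 1" l] ij jl by auto
    then have "B j" using dB[of l j] ij jl by auto
    then have "unstable_equilibrium a b r n j" using U idx j1 \<open>A j\<close> by blast
    then show ?thesis using side_has_equilibrium_iff[OF idx(3,4)] by blast
  qed
qed

end


section \<open>Equilibria of finely inscribed polygons\<close>

theorem theorem1:
  fixes r :: "real \<Rightarrow> real \<times> real" and a b \<rho> :: real
  assumes "a < 0" and "0 < b"
    and "C_k_curve 3 a b r"
    and "inj_on r {a..b}"
    and "\<And>t. t \<in> {a..b} \<Longrightarrow> 0 < fst (velocity a b r t)"
    and "0 < \<rho>" and "r 0 = (0, \<rho>)"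
    and "curve_equilibria a b r = {r 0}"
    and "1 + signed_curvature a b r 0 * \<rho> \<noteq> 0"
    and "1 + signed_curvature a b r 0 * \<rho> < 1"
  shows "(\<exists>\<delta>>0. \<forall>n>0. mesh a b n < \<delta> \<and> generic_equilibria a b r n \<longrightarrow>
            (\<exists>k K :: real. \<forall>i. i \<in> indices a b n \<and> i + 1 \<in> indices a b n \<longrightarrow>
               (side a b r n i \<inter> polygon_equilibria a b r n \<noteq> {} \<longleftrightarrow> k \<le> i \<and> i \<le> K)))
         \<and> (\<nexists>n i. (\<forall>k. generic_equilibria a b r (n k))
                   \<and> irregular_equilibrium_sequence a b r n i)"
proof -
  define v where "v = velocity a b r"
  define w where "w = velocity a b v"
  define q where "q t = r t \<bullet> v t" for t
  define q' where "q' t = v t \<bullet> v t + r t \<bullet> w t" for t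
  have ab: "a < b" and z: "0 \<in> {a..b}" using assms(1,2) by auto
  have diff: "r differentiable_on {a..b}" "v differentiable_on {a..b}" "w differentiable_on {a..b}"
    using assms(3) by (auto simp: numeral_3_eq_3 v_def w_def)
  have vd: "(f has_vector_derivative velocity a b f t) (at t within {a..b})"
    if "f differentiable_on {a..b}" "t \<in> {a..b}" for f :: "real \<Rightarrow> real \<times> real" and t
    using that vector_derivative_works[of f "at t within {a..b}"]
    by (simp add: differentiable_on_def velocity_def)
  have rv: "(r has_vector_derivative v t) (at t within {a..b})" if "t \<in> {a..b}" for t
    using vd[OF diff(1) that] by (simp add: v_def)
  have vw: "(v has_vector_derivative w t) (at t within {a..b})" if "t \<in> {a..b}" for t
    using vd[OF diff(2) that] by (simp add: w_def)
  have cont: "continuous_on {a..b} r" "continuous_on {a..b} v" "continuous_on {a..b} w"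
    using diff by (auto intro: differentiable_imp_continuous_on)
  have qq: "(q has_real_derivative q' t) (at t within {a..b})" if "t \<in> {a..b}" for t
  proof -
    have "(q has_derivative (\<lambda>h. h * q' t)) (at t within {a..b})"
      unfolding q_def q'_def
      using rv[OF that] vw[OF that] unfolding has_vector_derivative_def
      by (auto intro!: derivative_eq_intros simp: algebra_simps inner_commute)
    then show ?thesis by (simp add: has_field_derivative_def mult_commute_abs)
  qed
  have q'cont: "continuous_on {a..b} q'"
    unfolding q'_def by (intro continuous_intros cont)
  obtain L where L: "\<And>t s. t \<in> {a..b} \<Longrightarrow> s \<in> {a..b} \<Longrightarrow> norm (r s - r t) \<le> L * \<bar>s - t\<bar>"
    using C1_imp_lipschitz[OF rv cont(2)] by blast
  obtain C where C: "\<And>t s. t \<in> {a..b} \<Longrightarrow> s \<in> {a..b} \<Longrightarrow> \<bar>q s - q t\<bar> \<le> C * \<bar>s - t\<bar>"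
    using C1_imp_lipschitz[OF qq[unfolded has_real_derivative_iff_has_vector_derivative] q'cont]
    unfolding real_norm_def by blast

  \<comment> \<open>The equilibrium hypothesis speaks of points; injectivity turns it into one on parameters.\<close>
  have zero: "t = 0" if "t \<in> {a..b}" "q t = 0" for t
  proof -
    have "r t \<in> curve_equilibria a b r"
      using that by (auto simp: curve_equilibria_def q_def v_def)
    then show ?thesis using assms(4,8) that(1) z by (auto dest: inj_onD)
  qed
  have q0: "q 0 = 0"
  proof -
    have "r 0 \<in> curve_equilibria a b r" using assms(8) by simp
    then obtain t where "t \<in> {a..b}" "r t = r 0" "q t = 0"
      by (auto simp: curve_equilibria_def q_def v_def)
    then show ?thesis using assms(4) z by (metis inj_onD)
  qed
  \<comment> \<open>The velocity at \<open>0\<close> is horizontal, so the curvature is \<open>snd (w 0) / (fst (v 0))\<^sup>2\<close> there.\<close>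
  have c: "q' 0 \<noteq> 0"
  proof -
    have v2: "snd (v 0) = 0" using q0 assms(6,7) by (simp add: q_def inner_prod_def)
    have v1: "0 < fst (v 0)" using assms(5)[OF z] by (simp add: v_def)
    have "norm (v 0) = fst (v 0)" using v1 v2 by (simp add: norm_prod_def)
    then have "signed_curvature a b r 0 = snd (w 0) / (fst (v 0))\<^sup>2"
      using v1 v2 by (simp add: signed_curvature_def Let_def v_def[symmetric] w_def[symmetric]
          power2_eq_square power3_eq_cube)
    moreover have "q' 0 = (fst (v 0))\<^sup>2 + \<rho> * snd (w 0)"
      using v2 assms(7) by (simp add: q'_def inner_prod_def power2_eq_square)
    ultimately have "q' 0 = (fst (v 0))\<^sup>2 * (1 + signed_curvature a b r 0 * \<rho>)"
      using v1 by (simp add: field_simps)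
    then show ?thesis using v1 assms(9) by simp
  qed
  have "continuous_on {a..b} q" unfolding q_def by (intro continuous_intros cont)
  then obtain m where m: "0 < m" "\<And>t. t \<in> {a..b} \<Longrightarrow> m * \<bar>t\<bar> \<le> \<bar>q t\<bar>"
    using nonvanishing_imp_linear_lower_bound[OF _ qq[OF z] c q0 zero] by blast
  obtain M where M: "0 \<le> M" "\<And>t s h. 0 < h \<and> {t, t + h, s, s - h} \<subseteq> {a..b} \<and> \<bar>s - t\<bar> \<le> h
           \<and> approaches (r t) (r (t + h)) \<and> approaches (r s) (r (s - h)) \<Longrightarrow> \<bar>t\<bar> \<le> M * h"
    using two_sided_approach_only_near_0[OF rv L C[unfolded q_def] m[unfolded q_def]] by blast
  have "0 \<le> M + 2" using M(1) by simp
  from radial_increment_step_monotone[OF assms(1,2) rv cont(2) q0[unfolded q_def]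
      qq[OF z, unfolded q_def] c this]
  obtain \<delta> where \<delta>: "0 < \<delta>" "\<And>h u w. 0 < h \<Longrightarrow> h < \<delta> \<Longrightarrow> \<bar>u\<bar> \<le> M + 2 \<Longrightarrow> \<bar>w\<bar> \<le> M + 2 \<Longrightarrow> u + 1 \<le> w \<Longrightarrow>
     0 < q' 0 * (r (w * h) \<bullet> (r (w * h + h) - r (w * h)) - r (u * h) \<bullet> (r (u * h + h) - r (u * h)))
   \<and> 0 < q' 0 * (r (u * h) \<bullet> (r (u * h - h) - r (u * h)) - r (w * h) \<bullet> (r (w * h - h) - r (w * h)))"
    by blast

  have graph: "strict_mono_on {a..b} (\<lambda>t. fst (r t))"
  proof (rule strict_mono_onI)
    fix s t assume st: "s \<in> {a..b}" "t \<in> {a..b}" "s < t"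
    obtain x where x: "s < x" "x < t" "fst (r t) - fst (r s) = (\<lambda>h. h * fst (v x)) (t - s)"
    proof (rule mvt[OF st(3)])
      show "continuous_on {s..t} (\<lambda>t. fst (r t))"
        by (intro continuous_intros continuous_on_subset[OF cont(1)]) (use st in auto)
      fix x assume x: "s < x" "x < t"
      have "(r has_vector_derivative v x) (at x)"
        using rv[of x] x st at_within_Icc_at[of a x b] by auto
      then show "((\<lambda>t. fst (r t)) has_derivative (\<lambda>h. h * fst (v x))) (at x)"
        unfolding has_vector_derivative_def by (auto intro!: derivative_eq_intros)
    qed
    then have "0 < fst (v x)" using assms(5)[of x] st by (simp add: v_def)
    then have "0 < (t - s) * fst (v x)" using st by simp
    then show "fst (r s) < fst (r t)" using x(3) by simp
  qed
  have poly: "inscribed_polygon a b r n" if "0 < n" for n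
    using ab that graph by (simp add: inscribed_polygon_def)

  show ?thesis
  proof (rule conjI, rule exI[of _ \<delta>], rule conjI[OF \<delta>(1)], intro allI impI)
    fix n :: nat assume n: "0 < n" and small: "mesh a b n < \<delta> \<and> generic_equilibria a b r n"
    interpret inscribed_polygon a b r n by (rule poly[OF n])
    have h: "0 < mesh a b n" by (rule mesh_pos[OF ab n])
    define J where "J = {i \<in> I. i + 1 \<in> I}"
    define E where "E = {i \<in> J. side a b r n i \<inter> polygon_equilibria a b r n \<noteq> {}}"
    have "\<exists>k K. \<forall>i\<in>J. i \<in> E \<longleftrightarrow> k \<le> i \<and> i \<le> K"
    proof (rule order_convex_subset_is_interval)
      show "finite E" using finite_indices[OF ab n] by (rule rev_finite_subset) (auto simp: E_def J_def)
      show "E \<subseteq> J" by (auto simp: E_def)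
      fix i j l assume ijl: "i \<in> E" "l \<in> E" "j \<in> J" "i < j" "j < l"
      have mono: "0 < q' 0 * (p w \<bullet> (p (w + 1) - p w) - p u \<bullet> (p (u + 1) - p u))
          \<and> 0 < q' 0 * (p u \<bullet> (p (u - 1) - p u) - p w \<bullet> (p (w - 1) - p w))"
        if "\<bar>u\<bar> \<le> M + 2" "\<bar>w\<bar> \<le> M + 2" "u + 1 \<le> w" for u w
        using \<delta>(2)[OF h _ that] small unfolding vertex_step by (simp add: vertex_def)
      have U: "\<bar>u\<bar> \<le> M" if "unstable_equilibrium a b r n u" for u
        by (rule unstable_index_bound[OF _ that], rule M(2), assumption)
      have S: "\<bar>u\<bar> \<le> M" if "stable_equilibrium a b r n u z" for u z
        by (rule stable_index_bound[OF _ that], rule M(2), assumption)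
      have "side a b r n j \<inter> polygon_equilibria a b r n \<noteq> {}"
      proof (rule sides_with_equilibria_contiguous)
        show "q' 0 \<noteq> 0" by (rule c)
        show "side a b r n i \<inter> polygon_equilibria a b r n \<noteq> {}"
          "side a b r n l \<inter> polygon_equilibria a b r n \<noteq> {}"
          using ijl(1,2) unfolding E_def by blast+
      qed (use mono U S ijl in \<open>simp_all add: E_def J_def\<close>)
      then show "j \<in> E" using ijl(3) by (simp add: E_def)
    qed
    then show "\<exists>k K :: real. \<forall>i. i \<in> I \<and> i + 1 \<in> I \<longrightarrow>
        (side a b r n i \<inter> polygon_equilibria a b r n \<noteq> {} \<longleftrightarrow> k \<le> i \<and> i \<le> K)"
      by (simp add: E_def J_def)
  next
    show "\<nexists>n i. (\<forall>k. generic_equilibria a b r (n k)) \<and> irregular_equilibrium_sequence a b r n i"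
    proof
      assume "\<exists>n i. (\<forall>k. generic_equilibria a b r (n k)) \<and> irregular_equilibrium_sequence a b r n i"
      then obtain n i where irr: "irregular_equilibrium_sequence a b r n i" by blast
      have "i k \<le> M" for k
      proof -
        have n: "0 < n k" and ik: "i k \<in> indices a b (n k)"
          "vertex a b r (n k) (i k) \<in> polygon_equilibria a b r (n k)"
          using irr unfolding irregular_equilibrium_sequence_def by blast+
        interpret inscribed_polygon a b r "n k" by (rule poly[OF n])
        have "unstable_equilibrium a b r (n k) (i k)"
          using vertex_in_equilibria_iff[OF ik(1)] ik(2) by simp
        from unstable_index_bound[OF _ this] have "\<bar>i k\<bar> \<le> M" using M(2) by blast
        then show ?thesis by simp
      qed
      moreover have "\<forall>\<^sub>F k in sequentially. M + 1 \<le> i k"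
        using irr unfolding irregular_equilibrium_sequence_def filterlim_at_top by blast
      ultimately show False
        by (metis add_le_same_cancel1 eventually_sequentially nle_le not_one_le_zero order_trans)
    qed
  qed
qed

end
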